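(* Let $n\in\mathbb{N}$, $s,k\in\mathbb{Z}$ be such that $\nu_p(n)-\nu_p(k)\ne 1$ for every prime $p\mid n$. Let $m\in\mathbb{R}$. Write $n=n_1n_2$ with $n_1,n_2\in\mathbb{N}$, $(n_1,n_2)=1$, such that $\nu_p(n)\ge \nu_p(k)+2$ for every prime $p\mid n_1$, and $\nu_p(n)\le \nu_p(k)$ for every prime $p\mid n_2$. Then $$\sum_{\substack{a=1\\ (a,n)=1}}^n (a-s,n)^m e(ak/n) = e(ks/n)\, J_m(n_1)\,\varphi(n_2) \sum_{\substack{d\mid (n_1,k)\\ (n_1/d,s)=1}} d^{1-m} \sum_{\substack{d\mid n_2\\ (d,s)=1}} \frac{J_m(d)}{\varphi(d)},$$ $$\sum_{\substack{a=1\\ (a,n)=1}}^n \sigma_m((a-s,n))\, e(ak/n) = e(ks/n)\, n_1^m\,\varphi(n_2) \sum_{\substack{d\mid (n_1,k)\\ (n_1/d,s)=1}} d^{1-m} \sum_{\substack{d\mid n_2\\ (d,s)=1}} \frac{d^m}{\varphi(d)},$$ $$\sum_{\substack{a=1\\ (a,n)=1}}^n c_n(a-s)\, e(ak/n) = e(ks/n)\, n_1\,\varphi(n_2) \sum_{\substack{d\mid (n_1,k)\\ (n_1/d,s)=1}} \mu(d) \sum_{\substack{d\mid n_2\\ (d,s)=1}} \frac{d\,\mu(n_2/d)}{\varphi(d)}.$$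
   Context: $\mathbb{N}=\{1,2,\ldots\}$; $(a,b)$ is the greatest common divisor of $a,b\in\mathbb{Z}$; $\mu$ is the Möbius function; $\varphi$ is Euler's totient function; $e(x)=e^{2\pi i x}$ for $x\in\mathbb{R}$; $\sigma_m(n)=\sum_{d\mid n} d^m$; $J_m(n)=n^m\prod_{p\mid n}(1-1/p^m)$ for $m\in\mathbb{R}$ (Jordan function); $c_n(k)=\sum_{1\le a\le n,\,(a,n)=1} e(ak/n)$ is Ramanujan's sum ($n\in\mathbb{N}$, $k\in\mathbb{Z}$); $\nu_p(n)$ is the exponent of the prime $p$ in the prime factorization of $n\in\mathbb{Z}$, with the convention $\nu_p(0)=\infty$. All divisors in sums are positive. The decomposition $n=n_1n_2$ exists and is unique under the stated hypothesis: $n_1$ is the product of the prime powers $p^{\nu_p(n)}$ over primes $p\mid n$ with $\nu_p(n)\ge\nu_p(k)+2$, and $n_2$ is the product of $p^{\nu_p(n)}$ over primes $p\mid n$ with $\nu_p(n)\le\nu_p(k)$. *)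

theory Defs
  imports
    Complex_Main
    "HOL-Library.Extended_Nat"
    "HOL-Computational_Algebra.Squarefree"
    "HOL-Number_Theory.Number_Theory"
begin

definition expi :: "real \<Rightarrow> complex" where
  "expi x = exp (2 * of_real pi * \<i> * of_real x)"

text \<open>
  The library's \<^const>\<open>multiplicity\<close> is 0 at 0, whereas the convention here is
  \<open>\<nu>\<^sub>p(0) = \<infinity>\<close>; hence the values in \<^typ>\<open>enat\<close>.
  A difference condition such as \<open>\<nu>\<^sub>p(n) - \<nu>\<^sub>p(k) \<noteq> 1\<close> should be written
  additively, since subtraction on \<^typ>\<open>enat\<close> is truncated.
\<close>
definition padic_val :: "nat \<Rightarrow> int \<Rightarrow> enat" where
  "padic_val p n = (if n = 0 then \<infinity> else enat (multiplicity (int p) n))"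

definition moebius :: "nat \<Rightarrow> int" where
  "moebius n = (if squarefree n then (- 1) ^ card (prime_factors n) else 0)"

definition divisor_sigma :: "real \<Rightarrow> nat \<Rightarrow> real" where
  "divisor_sigma m n = (\<Sum>d | d dvd n. real d powr m)"

definition jordan :: "real \<Rightarrow> nat \<Rightarrow> real" where
  "jordan m n = real n powr m * (\<Prod>p\<in>prime_factors n. 1 - 1 / real p powr m)"

definition ramanujan_sum :: "nat \<Rightarrow> int \<Rightarrow> complex" where
  "ramanujan_sum n k =
     (\<Sum>a | a \<in> {1..n} \<and> coprime a n. expi (real a * real_of_int k / real n))"

end

theory Submission
  imports Defs
begin

text \<open>
  All three sums have the shape \<open>\<Sum>a. f(a) e(ak/n)\<close> over the units \<open>a\<close> modulo \<open>n\<close>,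
  where \<open>f(a)\<close> is a sum of \<open>g(d)\<close> over the common divisors \<open>d\<close> of \<open>n\<close> and \<open>a - s\<close>:
  \<open>g\<close> is \<open>J\<^sub>m(d)\<close> for the power of the gcd (because \<open>J\<^sub>m\<close> sums to \<open>n\<^sup>m\<close> over
  the divisors of \<open>n\<close>), \<open>d\<^sup>m\<close> for \<open>\<sigma>\<^sub>m\<close>, and \<open>d \<mu>(n/d)\<close> for Ramanujan's sum.
  After exchanging the two summations it remains to evaluate, for each divisor \<open>d\<close> of \<open>n\<close>,
  the sum \<open>T(d)\<close> of \<open>e(ak/n)\<close> over the units \<open>a\<close> with \<open>a \<equiv> s (mod d)\<close>.

  Write \<open>d = x y\<close> with \<open>x\<close> dividing \<open>n\<^sub>1\<close> and \<open>y\<close> dividing \<open>n\<^sub>2\<close>, and let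
  \<open>b = n\<^sub>1/x\<close>. The hypothesis on \<open>n\<^sub>2\<close> says that \<open>n\<^sub>2\<close> divides \<open>k\<close>. The value of
  \<open>T(d)\<close> is found in three cases (lemma \<open>twisted_residue_class_sum\<close>).

  If \<open>s\<close> and \<open>d\<close> are not coprime, there is no such \<open>a\<close>.

  If \<open>b\<close> does not divide \<open>k\<close>, some prime power \<open>q\<close> divides \<open>b\<close> but not \<open>k\<close>. As the
  valuations of \<open>n\<^sub>1\<close> exceed those of \<open>k\<close> by at least two, \<open>q\<close> can be chosen such that
  \<open>n/q\<close> is still divisible by every prime divisor of \<open>n\<close>. Translation by \<open>n/q\<close>
  then preserves both conditions on \<open>a\<close>, whereas it multiplies each term by
  \<open>e(k/q) \<noteq> 1\<close>; hence \<open>T(d) = 0\<close>.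

  Otherwise all terms are equal to \<open>e(ks/n)\<close>, because \<open>(a - s) k\<close> is divisible by
  \<open>x b n\<^sub>2 = n\<close>. Reduction modulo \<open>d\<close> maps the units modulo \<open>n\<close> onto those modulo
  \<open>d\<close> with fibres of equal size, so there are \<open>\<phi>(n)/\<phi>(d)\<close> terms. Since \<open>x\<close> has
  the same prime divisors as \<open>n\<^sub>1\<close>, this number is \<open>b \<phi>(n\<^sub>2)/\<phi>(y)\<close>.

  Summing over \<open>d\<close>, with \<open>b\<close> in place of \<open>x\<close> as the summation variable, splits the result
  into one sum over the common divisors of \<open>n\<^sub>1\<close> and \<open>k\<close> and one over the divisors of
  \<open>n\<^sub>2\<close>, provided that \<open>g(x y)\<close> factors accordingly
  (lemma \<open>twisted_unit_sum_of_divisor_sum\<close>).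
\<close>

section \<open>The additive character\<close>

lemma expi_add: "expi (x + y) = expi x * expi y"
  by (simp add: expi_def exp_add [symmetric] algebra_simps)

lemma expi_eq_1_iff: "expi x = 1 \<longleftrightarrow> x \<in> \<int>"
proof -
  have cis: "expi x = cis (2 * pi * x)"
    by (simp add: expi_def cis_conv_exp mult_ac)
  show ?thesis
  proof
    assume "expi x = 1"
    then have "cos (2 * pi * x) = 1"
      by (simp add: cis complex_eq_iff)
    then obtain j :: int where "2 * pi * x = j * 2 * pi"
      by (auto simp: cos_one_2pi_int)
    then have "x = of_int j" by simp
    then show "x \<in> \<int>" by simp
  qed (simp add: cis)
qed

lemma expi_divide_eq_1_iff:
  fixes b :: int and n :: nat
  assumes "n > 0"
  shows "expi (real_of_int b / real n) = 1 \<longleftrightarrow> int n dvd b"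
proof -
  have "real_of_int b / real n \<in> \<int> \<longleftrightarrow> int n dvd b"
  proof
    assume "real_of_int b / real n \<in> \<int>"
    then obtain j :: int where "real_of_int b / real n = of_int j"
      by (elim Ints_cases)
    then have "real_of_int b = of_int (j * int n)"
      using assms by (simp add: field_simps)
    then have "b = j * int n" by linarith
    then show "int n dvd b" by simp
  qed (use assms in \<open>auto elim!: dvdE\<close>)
  then show ?thesis by (simp add: expi_eq_1_iff)
qed

lemma expi_divide_cong:
  fixes a b :: int and n :: nat
  assumes "n > 0" "[a = b] (mod int n)"
  shows "expi (real_of_int a / real n) = expi (real_of_int b / real n)"
proof -
  have "expi (real_of_int a / real n)
      = expi (real_of_int b / real n) * expi (real_of_int (a - b) / real n)"
    by (simp add: expi_add [symmetric] diff_divide_distrib)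
  also have "expi (real_of_int (a - b) / real n) = 1"
    using assms by (simp add: expi_divide_eq_1_iff cong_iff_dvd_diff del: of_int_diff)
  finally show ?thesis by simp
qed

section \<open>Sums over residue systems\<close>

text \<open>
  An injective self-map of a finite set is bijective, so any map that is injective on residue
  classes merely permutes them. It is used for translations and for multiplication by units.
\<close>

lemma sum_over_residues_reindex:
  fixes F :: "int \<Rightarrow> 'a :: comm_monoid_add" and n :: int
  assumes n: "n > 0"
    and F: "\<And>a b. [a = b] (mod n) \<Longrightarrow> F a = F b"
    and h: "\<And>a b. [h a = h b] (mod n) \<Longrightarrow> [a = b] (mod n)"
  shows "(\<Sum>a\<in>{0..<n}. F (h a)) = (\<Sum>a\<in>{0..<n}. F a)"
proof -
  have inj: "inj_on (\<lambda>a. h a mod n) {0..<n}"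
    by (intro inj_onI) (metis atLeastLessThan_iff cong_def h mod_pos_pos_trivial)
  moreover have sub: "(\<lambda>a. h a mod n) ` {0..<n} \<subseteq> {0..<n}"
    using n by auto
  ultimately have "bij_betw (\<lambda>a. h a mod n) {0..<n} {0..<n}"
    by (simp add: bij_betw_def endo_inj_surj)
  from sum.reindex_bij_betw [OF this, of F]
  have "(\<Sum>a\<in>{0..<n}. F (h a mod n)) = (\<Sum>a\<in>{0..<n}. F a)" .
  moreover have "F (h a mod n) = F (h a)" for a
    by (rule F) (simp add: cong_def)
  ultimately show ?thesis by simp
qed

lemma sum_positive_representatives:
  fixes F :: "int \<Rightarrow> 'a :: comm_monoid_add" and n :: nat
  assumes F: "\<And>a b. [a = b] (mod int n) \<Longrightarrow> F a = F b"
  shows "(\<Sum>a\<in>{1..n}. F (int a)) = (\<Sum>a\<in>{0..<int n}. F a)"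
proof (cases "n = 0")
  case False
  have "(\<Sum>a\<in>{0..<int n}. F a) = (\<Sum>a\<in>{0..<int n}. F (a + 1))"
    using False F by (intro sum_over_residues_reindex [symmetric])
      (auto simp: cong_add_rcancel)
  also have "\<dots> = (\<Sum>a\<in>{1..n}. F (int a))"
    by (rule sum.reindex_bij_witness [of _ "\<lambda>a. int a - 1" "\<lambda>a. nat (a + 1)"]) auto
  finally show ?thesis ..
qed auto

text \<open>
  Passes from the representatives \<open>1, \<dots>, n\<close>, over which the sums in question are written,
  to the integers in \<open>{0..<n}\<close>, where translations and reductions are easier to handle.
\<close>

lemma sum_filter_residues:
  fixes F :: "int \<Rightarrow> 'a :: comm_monoid_add" and n :: nat
  assumes "\<And>a b. [a = b] (mod int n) \<Longrightarrow> P a = P b"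
    and "\<And>a b. [a = b] (mod int n) \<Longrightarrow> F a = F b"
  shows "(\<Sum>a | a \<in> {1..n} \<and> P (int a). F (int a))
       = (\<Sum>a\<in>{0..<int n}. if P a then F a else 0)"
proof -
  have "(\<Sum>a | a \<in> {1..n} \<and> P (int a). F (int a))
      = (\<Sum>a\<in>{1..n}. if P (int a) then F (int a) else 0)"
    using sum.inter_filter [of "{1..n}" "\<lambda>a. F (int a)" "\<lambda>a. P (int a)"] by simp
  also have "\<dots> = (\<Sum>a\<in>{0..<int n}. if P a then F a else 0)"
    by (rule sum_positive_representatives [where F = "\<lambda>a. if P a then F a else 0"])
       (use assms in metis)
  finally show ?thesis .
qed

lemma coprime_residue_cong:
  fixes a b n :: int
  assumes "[a = b] (mod n)"
  shows "coprime a n \<longleftrightarrow> coprime b n"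
  using assms by (metis cong_gcd_eq coprime_iff_gcd_eq_1)

lemma totient_eq_sum_residues:
  "(\<Sum>a\<in>{0..<int n}. if coprime a (int n) then 1 else 0) = (of_nat (totient n) :: 'a :: semiring_1)"
proof -
  have "(\<Sum>a\<in>{0..<int n}. if coprime a (int n) then 1 else 0 :: 'a)
      = (\<Sum>a | a \<in> {1..n} \<and> coprime (int a) (int n). 1)"
    by (rule sum_filter_residues [symmetric, where F = "\<lambda>_. 1"])
      (simp_all add: coprime_residue_cong)
  also have "{a. a \<in> {1..n} \<and> coprime (int a) (int n)} = totatives n"
    by (auto simp: totatives_def)
  finally show ?thesis by (simp add: totient_def)
qed

text \<open>
  Translating the summation variable by \<open>c\<close> permutes the terms and multiplies the sum by
  \<open>e(ck/n)\<close>, which differs from 1.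
\<close>

lemma twisted_sum_invariant_eq_0:
  fixes c k :: int and n :: nat
  assumes n: "n > 0"
    and P: "\<And>a b. [a = b] (mod int n) \<Longrightarrow> P a = P b"
    and shift: "\<And>a. P (a + c) = P a"
    and nd: "\<not> int n dvd c * k"
  shows "(\<Sum>a\<in>{0..<int n}. if P a then expi (real_of_int (a * k) / real n) else 0) = 0"
proof -
  define G where "G a = (if P a then expi (real_of_int (a * k) / real n) else 0)" for a
  have cong: "G a = G b" if "[a = b] (mod int n)" for a b
    using P [OF that] expi_divide_cong [OF n cong_scalar_right [OF that, of k]]
    by (simp add: G_def)
  have "G (a + c) = expi (real_of_int (c * k) / real n) * G a" for a
    by (simp add: G_def shift expi_add add_divide_distrib distrib_right)
  moreover have "(\<Sum>a\<in>{0..<int n}. G (a + c)) = (\<Sum>a\<in>{0..<int n}. G a)"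
    using n cong by (intro sum_over_residues_reindex) (auto simp: cong_add_rcancel)
  ultimately have "expi (real_of_int (c * k) / real n) * (\<Sum>a\<in>{0..<int n}. G a)
      = (\<Sum>a\<in>{0..<int n}. G a)"
    by (simp add: sum_distrib_left)
  moreover have "expi (real_of_int (c * k) / real n) \<noteq> 1"
    using nd expi_divide_eq_1_iff [OF n, of "c * k"] by blast
  ultimately have "(\<Sum>a\<in>{0..<int n}. G a) = 0" by simp
  then show ?thesis by (simp add: G_def)
qed

lemma coprime_if_no_common_prime:
  fixes a b :: "'a :: factorial_semiring_gcd"
  assumes "b \<noteq> 0" "\<And>p. prime p \<Longrightarrow> p dvd b \<Longrightarrow> \<not> p dvd a"
  shows "coprime a b"
proof (rule ccontr)
  assume "\<not> coprime a b"
  then have "\<not> is_unit (gcd a b)" by (simp add: coprime_iff_gcd_eq_1)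
  moreover have "gcd a b \<noteq> 0" using assms(1) by simp
  ultimately obtain p where "p dvd gcd a b" "prime p"
    using prime_divisor_exists by blast
  then show False using assms(2) [of p] by simp
qed

text \<open>
  Surjectivity of the reduction of units modulo \<open>n\<close> to units modulo \<open>d\<close>. Adding to \<open>r\<close>
  the multiple \<open>d t\<close>, where \<open>t\<close> is the product of the primes dividing \<open>n\<close> but not
  \<open>r\<close>, makes each prime divisor of \<open>n\<close> divide exactly one of the two summands.
\<close>

lemma coprime_lift:
  fixes r :: int and d n :: nat
  assumes "n > 0" "coprime r (int d)"
  obtains u where "[u = r] (mod int d)" "coprime u (int n)"
proof -
  define t where "t = (\<Prod>p\<in>{p\<in>prime_factors (int n). \<not> p dvd r}. p)"
  define u where "u = r + int d * t"
  have t_iff: "p dvd t \<longleftrightarrow> \<not> p dvd r" if p: "prime p" "p dvd int n" for p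
  proof
    assume "p dvd t"
    then obtain q where q: "q \<in> prime_factors (int n)" "\<not> q dvd r" "p dvd q"
      using p by (auto simp: t_def prime_dvd_prod_iff)
    then have "p = q" using p by (metis in_prime_factors_iff primes_dvd_imp_eq)
    with q show "\<not> p dvd r" by simp
  next
    assume "\<not> p dvd r"
    then show "p dvd t"
      using p \<open>n > 0\<close> unfolding t_def by (intro dvd_prodI) (auto simp: in_prime_factors_iff)
  qed
  have "\<not> p dvd u" if p: "prime p" "p dvd int n" for p
  proof (cases "p dvd r")
    case True
    then have "\<not> p dvd int d"
      using assms p by (meson coprime_common_divisor not_prime_unit)
    with True t_iff [OF p] show ?thesis
      using p by (auto simp: u_def dvd_add_right_iff prime_dvd_mult_iff)
  next
    case False
    then show ?thesis
      using t_iff [OF p] by (auto simp: u_def dvd_add_left_iff)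
  qed
  then have "coprime u (int n)"
    using \<open>n > 0\<close> by (intro coprime_if_no_common_prime) auto
  moreover have "[u = r] (mod int d)"
    by (simp add: u_def cong_iff_dvd_diff)
  ultimately show ?thesis using that by blast
qed

text \<open>
  Multiplication by a unit modulo \<open>n\<close> that lifts \<open>r\<close> maps the fibre over 1 bijectively onto
  the fibre over \<open>r\<close>. So all fibres of the reduction have the same size, and their sizes
  add up to \<open>\<phi>(n)\<close>.
\<close>

lemma count_lifts:
  fixes s :: int and d n :: nat
  assumes n: "n > 0" and d: "d dvd n" and s: "coprime s (int d)"
  shows "of_nat (totient d) *
      (\<Sum>a\<in>{0..<int n}. if coprime a (int n) \<and> [a = s] (mod int d) then 1 else 0)
      = (of_nat (totient n) :: 'a :: comm_semiring_1)"
proof -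
  define N :: "int \<Rightarrow> 'a" where
    "N r = (\<Sum>a\<in>{0..<int n}. if coprime a (int n) \<and> [a = r] (mod int d) then 1 else 0)" for r
  have "d > 0" using n d by (simp add: dvd_pos_nat)
  have N1: "N r = N 1" if r: "coprime r (int d)" for r
  proof -
    obtain u where u: "[u = r] (mod int d)" "coprime u (int n)"
      using coprime_lift [OF n r] .
    have ud: "coprime u (int d)"
      using u(2) d by (meson coprime_divisors dvd_refl int_dvd_int_iff)
    have iff: "[u * a = r] (mod int d) \<longleftrightarrow> [a = 1] (mod int d)" for a
      using cong_mult_lcancel [OF ud, of a 1] u(1) by (simp, meson cong_sym cong_trans)
    have "N r = (\<Sum>a\<in>{0..<int n}. if coprime (u * a) (int n) \<and> [u * a = r] (mod int d) then 1 else 0)"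
      unfolding N_def
    proof (rule sum_over_residues_reindex [symmetric])
      fix a b assume ab: "[a = b] (mod int n)"
      then have "[a = b] (mod int d)" using d by (meson cong_dvd_modulus int_dvd_int_iff)
      then show "(if coprime a (int n) \<and> [a = r] (mod int d) then 1 else 0 :: 'a)
          = (if coprime b (int n) \<and> [b = r] (mod int d) then 1 else 0)"
        using coprime_residue_cong [OF ab] by (meson cong_sym cong_trans)
    qed (use n u in \<open>auto simp: cong_mult_lcancel\<close>)
    also have "\<dots> = N 1"
      unfolding N_def iff using u(2) by (simp add: coprime_mult_left_iff)
    finally show ?thesis .
  qed
  have "(\<Sum>r\<in>{0..<int d}. if coprime r (int d) then N r else 0)
      = (\<Sum>r\<in>{0..<int d}. N 1 * (if coprime r (int d) then 1 else 0))"
    by (intro sum.cong refl) (auto intro: N1)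
  also have "\<dots> = N 1 * of_nat (totient d)"
    by (simp only: sum_distrib_left [symmetric] totient_eq_sum_residues)
  also have "(\<Sum>r\<in>{0..<int d}. if coprime r (int d) then N r else 0)
      = (\<Sum>r\<in>{0..<int d}. \<Sum>a\<in>{0..<int n}.
           if coprime a (int n) \<and> r = a mod int d then 1 else 0)"
  proof (intro sum.cong refl)
    fix r assume r: "r \<in> {0..<int d}"
    have "[a = r] (mod int d) \<longleftrightarrow> r = a mod int d" for a
      using r by (auto simp: cong_def)
    moreover have "coprime r (int d)" if "coprime a (int n)" "r = a mod int d" for a
      using that d \<open>d > 0\<close> by (metis coprime_divisors coprime_mod_left_iff dvd_refl int_dvd_int_iff of_nat_0_less_iff less_irrefl)
    ultimately show "(if coprime r (int d) then N r else 0)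
        = (\<Sum>a\<in>{0..<int n}. if coprime a (int n) \<and> r = a mod int d then 1 else 0)"
    proof (cases "coprime r (int d)")
      case False
      with \<open>\<And>a. coprime a (int n) \<Longrightarrow> r = a mod int d \<Longrightarrow> coprime r (int d)\<close>
      have "\<not> (coprime a (int n) \<and> r = a mod int d)" for a by blast
      with False show ?thesis by (simp only: if_False sum.neutral_const)
    qed (simp add: N_def)
  qed
  also have "\<dots> = (\<Sum>a\<in>{0..<int n}. \<Sum>r\<in>{0..<int d}.
           if coprime a (int n) \<and> r = a mod int d then 1 else 0)"
    by (rule sum.swap)
  also have "\<dots> = (\<Sum>a\<in>{0..<int n}. if coprime a (int n) then 1 else 0)"
    using \<open>d > 0\<close> by (intro sum.cong refl) (auto simp: sum.delta)
  also have "\<dots> = of_nat (totient n)" by (rule totient_eq_sum_residues)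
  finally show ?thesis
    using N1 [OF s] by (simp add: N_def mult.commute)
qed

section \<open>Sums over the divisors of a product of coprime numbers\<close>

text \<open>
  Taking the gcd with \<open>a\<close> and with \<open>b\<close> recovers the two factors of a divisor of \<open>a b\<close>.
\<close>

lemma sum_divisors_coprime_product:
  fixes g :: "nat \<Rightarrow> 'a :: comm_monoid_add"
  assumes "coprime a b" "a > 0" "b > 0"
  shows "(\<Sum>d | d dvd a * b. g d) = (\<Sum>x | x dvd a. \<Sum>y | y dvd b. g (x * y))"
proof -
  have gcd_l: "gcd (x * y) a = x" if "x dvd a" "y dvd b" for x y
  proof -
    have "coprime y a" using that assms(1) by (meson coprime_commute coprime_divisors dvd_refl)
    then have "gcd (x * y) a = gcd x a"
      by (simp add: gcd_mult_right_right_cancel gcd_mult_left_right_cancel coprime_commute)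
    then show ?thesis using that by (simp add: gcd_nat.absorb1)
  qed
  have gcd_r: "gcd (x * y) b = y" if "x dvd a" "y dvd b" for x y
  proof -
    have "coprime x b" using that assms(1) by (meson coprime_commute coprime_divisors dvd_refl)
    then have "gcd (x * y) b = gcd y b"
      by (simp add: gcd_mult_left_left_cancel coprime_commute)
    then show ?thesis using that by (simp add: gcd_nat.absorb1)
  qed
  have "(\<Sum>x | x dvd a. \<Sum>y | y dvd b. g (x * y))
      = (\<Sum>z\<in>{x. x dvd a} \<times> {y. y dvd b}. g (fst z * snd z))"
    by (simp add: sum.cartesian_product case_prod_beta)
  also have "\<dots> = (\<Sum>d | d dvd a * b. g d)"
  proof (rule sum.reindex_bij_witness [of _ "\<lambda>d. (gcd d a, gcd d b)" "\<lambda>z. fst z * snd z"])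
    fix d assume "d \<in> {d. d dvd a * b}"
    then obtain x y where "d = x * y" "x dvd a" "y dvd b"
      using division_decomp [of d a b] by auto
    then show "fst (gcd d a, gcd d b) * snd (gcd d a, gcd d b) = d"
      by (simp add: gcd_l gcd_r)
  qed (auto simp: gcd_l gcd_r mult_dvd_mono)
  finally show ?thesis ..
qed

lemma sum_divisors_complementary:
  fixes f :: "nat \<Rightarrow> 'a :: comm_monoid_add"
  assumes "n > 0"
  shows "(\<Sum>d | d dvd n. f d) = (\<Sum>d | d dvd n. f (n div d))"
  by (rule sum.reindex_bij_witness [of _ "\<lambda>d. n div d" "\<lambda>d. n div d"])
     (use assms in \<open>auto elim!: dvdE\<close>)

text \<open>
  An identity between a multiplicative function and the divisor sum of another one
  needs to be verified only at prime powers: split off the full power of one prime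
  and use induction for the cofactor.
\<close>

lemma sum_divisors_multiplicative:
  fixes g F :: "nat \<Rightarrow> 'a :: comm_semiring_1"
  assumes g1: "g 1 = 1" and F1: "F 1 = 1"
    and g_mult: "\<And>a b. coprime a b \<Longrightarrow> a > 0 \<Longrightarrow> b > 0 \<Longrightarrow> g (a * b) = g a * g b"
    and F_mult: "\<And>a b. coprime a b \<Longrightarrow> a > 0 \<Longrightarrow> b > 0 \<Longrightarrow> F (a * b) = F a * F b"
    and primepow: "\<And>p e. prime p \<Longrightarrow> e > 0 \<Longrightarrow> (\<Sum>j\<le>e. g (p ^ j)) = F (p ^ e)"
    and "n > 0"
  shows "(\<Sum>d | d dvd n. g d) = F n"
  using \<open>n > 0\<close>
proof (induction n rule: less_induct)
  case (less n)
  show ?case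
  proof (cases "n = 1")
    case True
    then show ?thesis using g1 F1 by simp
  next
    case False
    then obtain p where p: "prime p" "p dvd n" using prime_factor_nat by blast
    define e where "e = multiplicity p n"
    obtain b where b: "n = p ^ e * b" "\<not> p dvd b"
      unfolding e_def by (rule multiplicity_decompose' [of n p]) (use p less.prems in auto)
    have e: "e > 0" using b p by (cases e) auto
    have "b > 0" using b less.prems by (cases b) auto
    have cop: "coprime (p ^ e) b"
      using p b by (simp add: prime_imp_coprime)
    have "1 < p ^ e" using prime_gt_1_nat [OF p(1)] e by (rule one_less_power)
    then have "b < n" using b \<open>b > 0\<close> by simp
    have "(\<Sum>x | x dvd p ^ e. g x) = (\<Sum>j\<le>e. g (p ^ j))"
    proof -
      have "{x. x dvd p ^ e} = (\<lambda>j. p ^ j) ` {..e}"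
        using p by (auto simp: divides_primepow_nat)
      moreover have "inj_on (\<lambda>j. p ^ j) {..e}"
        using prime_gt_1_nat [OF p(1)] by (auto simp: inj_on_def)
      ultimately show ?thesis by (simp add: sum.reindex)
    qed
    then have pe: "(\<Sum>x | x dvd p ^ e. g x) = F (p ^ e)" using primepow p e by simp
    have "(\<Sum>d | d dvd n. g d) = (\<Sum>x | x dvd p ^ e. \<Sum>y | y dvd b. g (x * y))"
      unfolding b(1) using cop \<open>b > 0\<close> p
      by (intro sum_divisors_coprime_product) (auto simp: prime_gt_0_nat)
    also have "\<dots> = (\<Sum>x | x dvd p ^ e. \<Sum>y | y dvd b. g x * g y)"
    proof (intro sum.cong refl g_mult)
      fix x y assume "x \<in> {x. x dvd p ^ e}" "y \<in> {y. y dvd b}"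
      then have xy: "x dvd p ^ e" "y dvd b" by simp_all
      show "coprime x y" using xy cop by (rule coprime_divisors)
      show "x > 0" using dvd_pos_nat [OF _ xy(1)] p by (simp add: prime_gt_0_nat)
      show "y > 0" using dvd_pos_nat [OF _ xy(2)] \<open>b > 0\<close> by simp
    qed
    also have "\<dots> = F (p ^ e) * F b"
      using pe less.IH [OF \<open>b < n\<close> \<open>b > 0\<close>] by (simp flip: sum_product)
    also have "\<dots> = F n"
      using F_mult [OF cop] p \<open>b > 0\<close> b(1) by (simp add: prime_gt_0_nat)
    finally show ?thesis .
  qed
qed

section \<open>Jordan function and Moebius function\<close>

lemma coprime_prime_factors_disjoint:
  fixes a b :: nat
  assumes "coprime a b"
  shows "prime_factors a \<inter> prime_factors b = {}"
proof -
  have False if "p \<in> prime_factors a" "p \<in> prime_factors b" for p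
    using coprime_common_divisor [OF assms, of p] that by (auto simp: in_prime_factors_iff)
  then show ?thesis by blast
qed

lemma jordan_mult_coprime:
  assumes "coprime a b" "a > 0" "b > 0"
  shows "jordan m (a * b) = jordan m a * jordan m b"
  using assms coprime_prime_factors_disjoint [OF assms(1)]
  by (simp add: jordan_def prime_factors_product prod.union_disjoint powr_mult)

text \<open>
  In this form the sum over the divisors of a prime power telescopes.
\<close>

lemma jordan_prime_power:
  assumes "prime p" "j > 0"
  shows "jordan m (p ^ j) = real (p ^ j) powr m - real (p ^ (j - 1)) powr m"
proof -
  have p: "real p > 0" using assms(1) by (simp add: prime_gt_0_nat)
  obtain i where j: "j = Suc i" using assms(2) by (cases j) auto
  have pj: "real (p ^ j) powr m = real p powr m * real (p ^ i) powr m"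
    using p by (simp add: j powr_mult)
  have "jordan m (p ^ j) = real (p ^ j) powr m * (1 - 1 / real p powr m)"
    unfolding jordan_def prime_factors_power [OF assms(2)] prime_prime_factors [OF assms(1)] by simp
  also have "\<dots> = real p powr m * real (p ^ i) powr m - real (p ^ i) powr m"
    unfolding pj using p by (simp add: right_diff_distrib del: of_nat_power)
  finally show ?thesis unfolding pj by (simp only: j diff_Suc_1)
qed

lemma sum_divisors_jordan:
  assumes "n > 0"
  shows "(\<Sum>d | d dvd n. jordan m d) = real n powr m"
proof (rule sum_divisors_multiplicative [where F = "\<lambda>n. real n powr m"])
  fix p e :: nat
  assume p: "prime p"
  show "(\<Sum>j\<le>e. jordan m (p ^ j)) = real (p ^ e) powr m"
    by (induction e) (use p in \<open>simp_all add: jordan_prime_power jordan_def [of m "Suc 0"] del: of_nat_power power_Suc\<close>)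
qed (use assms in \<open>auto simp: jordan_mult_coprime powr_mult jordan_def [of m "Suc 0"]\<close>)

lemma moebius_mult_coprime:
  assumes "coprime a b" "a > 0" "b > 0"
  shows "moebius (a * b) = moebius a * moebius b"
proof (cases "squarefree a \<and> squarefree b")
  case True
  then show ?thesis
    using assms coprime_prime_factors_disjoint [OF assms(1)]
    by (simp add: moebius_def squarefree_mult_coprime prime_factors_product card_Un_disjoint power_add)
next
  case False
  then have "\<not> squarefree (a * b)"
    by (meson dvd_triv_left dvd_triv_right squarefree_mono)
  with False show ?thesis by (auto simp: moebius_def)
qed

lemma sum_divisors_moebius:
  assumes "n > 0"
  shows "(\<Sum>d | d dvd n. moebius d) = (if n = 1 then 1 else 0)"
proof (rule sum_divisors_multiplicative [where F = "\<lambda>n. if n = 1 then 1 else 0"])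
  fix p e :: nat
  assume p: "prime p" and e: "e > 0"
  have val: "moebius (p ^ j) = (if j = 0 then 1 else if j = 1 then -1 else 0)" for j
    using p by (auto simp: moebius_def squarefree_power_iff squarefree_prime prime_prime_factors)
  have "(\<Sum>j\<le>e. moebius (p ^ j)) = (\<Sum>j\<in>{0,1}. moebius (p ^ j))"
    using e by (intro sum.mono_neutral_right) (auto simp: val)
  then show "(\<Sum>j\<le>e. moebius (p ^ j)) = (if p ^ e = 1 then 1 else 0)"
    using p e by (auto simp: val)
qed (use assms in \<open>auto simp: moebius_mult_coprime moebius_def [of "Suc 0"]\<close>)

section \<open>Ramanujan sums\<close>

lemma sum_character_all_residues:
  fixes k :: int and n :: nat
  assumes "n > 0"
  shows "(\<Sum>a\<in>{1..n}. expi (real a * real_of_int k / real n)) = (if int n dvd k then of_nat n else 0)"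
proof (cases "int n dvd k")
  case True
  have "expi (real a * real_of_int k / real n) = 1" for a
    using expi_divide_eq_1_iff [OF assms, of "int a * k"] True by simp
  with True show ?thesis by simp
next
  case False
  have "(\<Sum>a\<in>{1..n}. expi (real a * real_of_int k / real n))
      = (\<Sum>a\<in>{1..n}. expi (real_of_int (int a * k) / real n))"
    by simp
  also have "\<dots> = (\<Sum>a\<in>{0..<int n}. expi (real_of_int (a * k) / real n))"
    by (rule sum_positive_representatives) (intro expi_divide_cong assms cong_scalar_right)
  also have "\<dots> = 0"
    using twisted_sum_invariant_eq_0 [OF assms, of "\<lambda>_. True" 1 k] False by simp
  finally show ?thesis using False by simp
qed

text \<open>
  Moebius inversion replaces the condition that \<open>a\<close> and \<open>n\<close> are coprime by a sum over
  the common divisors \<open>e\<close> of \<open>a\<close> and \<open>n\<close>. For fixed \<open>e\<close> the terms with \<open>a = e b\<close>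
  form a complete character sum modulo \<open>n/e\<close>.
\<close>

lemma ramanujan_sum_divisor_formula:
  assumes n: "n > 0"
  shows "ramanujan_sum n k
       = of_int (\<Sum>d | d dvd n \<and> int d dvd k. int d * moebius (n div d))"
proof -
  define E where "E a = expi (real a * real_of_int k / real n)" for a
  have fin: "finite {e. e dvd n}" using n by simp
  have ind: "(if coprime a n then E a else 0)
      = (\<Sum>e | e dvd n. if e dvd a then of_int (moebius e) * E a else 0)" for a
  proof -
    have gcd_1: "gcd a n = 1 \<longleftrightarrow> coprime a n" by (rule coprime_iff_gcd_eq_1 [symmetric])
    have set_eq: "{e \<in> {e. e dvd n}. e dvd a} = {e. e dvd gcd a n}" by auto
    have "(\<Sum>e | e dvd n. if e dvd a then of_int (moebius e) * E a else 0)
        = (\<Sum>e | e dvd gcd a n. of_int (moebius e) * E a)"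
      using sum.inter_filter [OF fin, of "\<lambda>e. of_int (moebius e) * E a" "\<lambda>e. e dvd a"]
      unfolding set_eq by (rule sym)
    also have "\<dots> = of_int (\<Sum>e | e dvd gcd a n. moebius e) * E a"
      by (simp add: sum_distrib_right)
    also have "\<dots> = (if coprime a n then E a else 0)"
      using n by (subst sum_divisors_moebius) (simp_all only: gcd_1, auto)
    finally show ?thesis ..
  qed
  have inner: "(\<Sum>a\<in>{1..n}. if e dvd a then E a else 0)
      = (if int (n div e) dvd k then of_nat (n div e) else 0)" if e: "e dvd n" for e
  proof -
    obtain f where f: "n = e * f" using e by (elim dvdE)
    have pos: "e > 0" "f > 0" using n f by auto
    have "(\<Sum>a\<in>{1..n}. if e dvd a then E a else 0) = (\<Sum>a | a \<in> {1..n} \<and> e dvd a. E a)"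
      using sum.inter_filter [of "{1..n}" E "\<lambda>a. e dvd a"] by simp
    also have "\<dots> = (\<Sum>b\<in>{1..f}. E (e * b))"
      by (rule sum.reindex_bij_witness [of _ "\<lambda>b. e * b" "\<lambda>a. a div e"])
         (use pos in \<open>auto simp: f Suc_le_eq\<close>)
    also have "\<dots> = (\<Sum>b\<in>{1..f}. expi (real b * real_of_int k / real f))"
      using pos by (intro sum.cong refl) (simp add: E_def f)
    also have "\<dots> = (if int f dvd k then of_nat f else 0)"
      using pos by (intro sum_character_all_residues)
    finally show ?thesis using f pos by simp
  qed
  have "ramanujan_sum n k = (\<Sum>a\<in>{1..n}. if coprime a n then E a else 0)"
    unfolding ramanujan_sum_def E_def
    using sum.inter_filter [of "{1..n}" "\<lambda>a. expi (real a * real_of_int k / real n)"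
        "\<lambda>a. coprime a n"] by simp
  also have "\<dots> = (\<Sum>e | e dvd n. \<Sum>a\<in>{1..n}. if e dvd a then of_int (moebius e) * E a else 0)"
    unfolding ind by (rule sum.swap)
  also have "\<dots> = (\<Sum>e | e dvd n. of_int (moebius e) * (\<Sum>a\<in>{1..n}. if e dvd a then E a else 0))"
    unfolding sum_distrib_left by (intro sum.cong refl) simp
  also have "\<dots> = (\<Sum>e | e dvd n. of_int (moebius e) * (if int (n div e) dvd k then of_nat (n div e) else 0))"
    by (intro sum.cong refl) (simp only: mem_Collect_eq inner)
  also have "\<dots> = (\<Sum>d | d dvd n. of_int (moebius (n div d)) * (if int d dvd k then of_nat d else 0))"
  proof (subst sum_divisors_complementary [OF n], intro sum.cong refl)
    fix d assume "d \<in> {d. d dvd n}"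
    then have "n div (n div d) = d" using n by (auto elim!: dvdE)
    then show "of_int (moebius (n div d)) * (if int (n div (n div d)) dvd k then of_nat (n div (n div d)) else 0)
      = (of_int (moebius (n div d)) * (if int d dvd k then of_nat d else 0) :: complex)" by simp
  qed
  also have "\<dots> = (\<Sum>d | d dvd n. if int d dvd k then of_int (int d * moebius (n div d)) else 0)"
    by (intro sum.cong refl) simp
  also have "\<dots> = of_int (\<Sum>d | d dvd n \<and> int d dvd k. int d * moebius (n div d))"
    using sum.inter_filter [OF fin, of "\<lambda>d. of_int (int d * moebius (n div d)) :: complex" "\<lambda>d. int d dvd k"]
    by simp
  finally show ?thesis .
qed

section \<open>Twisted sums over the units in a residue class\<close>

lemma prime_power_witness_not_dvd:
  fixes b :: nat and k :: int
  assumes "b > 0" "\<not> int b dvd k"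
  obtains p j where "prime p" "p ^ j dvd b" "\<not> int (p ^ j) dvd k"
proof -
  have k: "nat \<bar>k\<bar> \<noteq> 0" and "\<not> b dvd nat \<bar>k\<bar>"
    using assms(2) by (auto simp: dvd_nat_abs_iff)
  then obtain p where p: "prime p" "multiplicity p (nat \<bar>k\<bar>) < multiplicity p b"
    using assms(1) multiplicity_le_imp_dvd [of b "nat \<bar>k\<bar>"] by (metis not_le less_irrefl)
  have "\<not> p ^ multiplicity p b dvd nat \<bar>k\<bar>"
    using p k by (subst power_dvd_iff_le_multiplicity) auto
  then have "\<not> int (p ^ multiplicity p b) dvd k"
    by (simp add: dvd_nat_abs_iff)
  then show ?thesis using that p(1) multiplicity_dvd by blast
qed

lemma totient_same_prime_factors:
  assumes "prime_factors (a * b) = prime_factors a" "b > 0"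
  shows "totient (a * b) = b * totient a"
proof -
  have "real (totient (a * b)) = real (b * totient a)"
    by (simp add: totient_formula2 assms)
  then show ?thesis by (simp only: of_nat_eq_iff)
qed

text \<open>
  Being coprime to \<open>n\<close> depends only on the residues modulo the primes that divide \<open>n\<close>.
\<close>

lemma coprime_add_radical_multiple:
  fixes a c n :: int
  assumes "n \<noteq> 0" "\<And>p. prime p \<Longrightarrow> p dvd n \<Longrightarrow> p dvd c"
  shows "coprime (a + c) n \<longleftrightarrow> coprime a n"
proof -
  have "coprime (b + e) n" if "coprime b n" "\<And>p. prime p \<Longrightarrow> p dvd n \<Longrightarrow> p dvd e" for b e
  proof (rule coprime_if_no_common_prime [OF assms(1)])
    fix p assume p: "prime p" "p dvd n"
    then have "\<not> p dvd b"
      using that(1) by (meson coprime_common_divisor not_prime_unit)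
    with that(2) [OF p] show "\<not> p dvd b + e" by (simp add: dvd_add_left_iff)
  qed
  from this [of a c] this [of "a + c" "- c"] show ?thesis using assms(2) by auto
qed

text \<open>
  For \<open>n > 0\<close> this is equivalent to \<open>\<nu>\<^sub>p(n) \<ge> \<nu>\<^sub>p(k) + 2\<close> for each prime \<open>p\<close> dividing \<open>n\<close>: the
  admissible \<open>v\<close> are those with \<open>\<nu>\<^sub>p(k) \<le> v \<le> \<nu>\<^sub>p(n) - 2\<close>. Expressed by divisibility,
  it covers \<open>k = 0\<close> with the convention \<open>\<nu>\<^sub>p(0) = \<infinity>\<close>, as no \<open>v\<close> exists then.
\<close>

definition valuation_gap :: "nat \<Rightarrow> int \<Rightarrow> bool" where
  "valuation_gap n k \<longleftrightarrow>
    (\<forall>p. prime p \<longrightarrow> p dvd n \<longrightarrow> (\<exists>v. p ^ (v + 2) dvd n \<and> \<not> int (p ^ (v + 1)) dvd k))"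

text \<open>
  If \<open>p\<close> did not divide \<open>x\<close>, the full power of \<open>p\<close> in \<open>n\<close> would divide \<open>b\<close> and hence
  \<open>k\<close>, although the valuation of \<open>k\<close> is smaller.
\<close>

lemma valuation_gap_prime_factors:
  assumes gap: "valuation_gap n k" and "n > 0" and n: "n = x * b" and b: "int b dvd k"
  shows "prime_factors n = prime_factors x"
proof -
  have "p dvd x" if p: "prime p" "p dvd n" for p
  proof (rule ccontr)
    assume "\<not> p dvd x"
    obtain v where v: "p ^ (v + 2) dvd n" "\<not> int (p ^ (v + 1)) dvd k"
      using gap p unfolding valuation_gap_def by blast
    have "coprime (p ^ (v + 2)) x"
      using p \<open>\<not> p dvd x\<close> by (simp add: prime_imp_coprime)
    then have "p ^ (v + 2) dvd b"
      using v(1) unfolding n by (simp only: coprime_dvd_mult_right_iff)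
    moreover have "p ^ (v + 1) dvd p ^ (v + 2)" by (rule le_imp_power_dvd) simp
    ultimately have "int (p ^ (v + 1)) dvd k"
      using b by (meson dvd_trans int_dvd_int_iff)
    with v(2) show False by contradiction
  qed
  then show ?thesis using \<open>n > 0\<close> n by (auto simp: prime_factors_dvd)
qed

text \<open>
  Supplies the translation that makes the twisted sum vanish when \<open>b\<close> does not divide
  \<open>k\<close>: \<open>c = n/q\<close> for a prime power \<open>q\<close> that divides \<open>b\<close> but not \<open>k\<close>. As \<open>x y q\<close>
  divides \<open>n\<close>, translation by \<open>c\<close> fixes the class modulo \<open>x y\<close>. As \<open>p q\<close> divides
  \<open>n\<close> for the prime \<open>p\<close> underlying \<open>q\<close>, every prime divisor of \<open>n\<close> divides \<open>c\<close>, so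
  that the translation also preserves units.
\<close>

lemma valuation_gap_shift:
  fixes n n1 n2 x y b :: nat and k :: int
  assumes "n > 0" "n = n1 * n2" and gap: "valuation_gap n1 k"
    and n1: "n1 = x * b" and y: "y dvd n2" and b: "\<not> int b dvd k"
  obtains c :: nat where "x * y dvd c" "\<not> int n dvd int c * k"
    "\<And>p :: int. prime p \<Longrightarrow> p dvd int n \<Longrightarrow> p dvd int c"
proof -
  have "b > 0" using assms by auto
  then obtain p j where p: "prime p" "p ^ j dvd b" "\<not> int (p ^ j) dvd k"
    using prime_power_witness_not_dvd b by metis
  have "j > 0" using p(3) by (cases j) auto
  then have "p dvd n1"
    using p(2) n1 by (metis dvd_power dvd_trans dvd_triv_right)
  then obtain v where v: "p ^ (v + 2) dvd n1" "\<not> int (p ^ (v + 1)) dvd k"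
    using gap p(1) unfolding valuation_gap_def by blast
  \<comment> \<open>The exponent \<open>j\<close> could be as large as the valuation of \<open>n\<^sub>1\<close>. The bound \<open>v + 1\<close> leaves room for another factor \<open>p\<close>.\<close>
  define q where "q = p ^ min j (v + 1)"
  have qb: "q dvd b"
    unfolding q_def by (rule dvd_trans [OF le_imp_power_dvd p(2)]) simp
  have qk: "\<not> int q dvd k"
    using p(3) v(2) by (simp add: q_def min_def)
  have "p * q dvd n1"
  proof -
    have "p * q = p ^ (min j (v + 1) + 1)" by (simp add: q_def)
    also have "\<dots> dvd p ^ (v + 2)" by (rule le_imp_power_dvd) simp
    finally show ?thesis using v(1) by (rule dvd_trans)
  qed
  then have pqn: "p * q dvd n" using assms(2) by simp
  then obtain c where c: "n = c * q"
    by (metis dvd_def dvd_mult_right mult.commute)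
  have "q > 0" "c > 0" using c \<open>n > 0\<close> by auto
  have "x * y * q dvd c * q"
  proof -
    have "(x * q) * y dvd n1 * n2"
      using qb y unfolding n1 by (intro mult_dvd_mono) auto
    then show ?thesis using c assms(2) by (simp add: mult_ac)
  qed
  then have 1: "x * y dvd c" using \<open>q > 0\<close> by simp
  have 2: "\<not> int n dvd int c * k"
    using qk \<open>c > 0\<close> by (simp add: c)
  have "p dvd c" using pqn \<open>q > 0\<close> unfolding c by simp
  have 3: "r dvd int c" if r: "prime r" "r dvd int n" for r :: int
  proof -
    have "r dvd int c \<or> r dvd int p ^ min j (v + 1)"
      using r by (simp add: c q_def prime_dvd_mult_iff)
    then show ?thesis
      using r(1) \<open>p dvd c\<close> by (meson dvd_trans int_dvd_int_iff prime_dvd_power)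
  qed
  from 1 2 3 show ?thesis by (rule that)
qed

text \<open>
  The evaluation of \<open>T(x y)\<close>; the three cases are those of the introduction.
\<close>

lemma twisted_residue_class_sum:
  fixes n n1 n2 x y b :: nat and s k :: int
  assumes n: "n > 0" "n = n1 * n2" and cop: "coprime n1 n2"
    and gap: "valuation_gap n1 k" and n2: "int n2 dvd k"
    and n1: "n1 = x * b" and y: "y dvd n2"
  shows "(\<Sum>a\<in>{0..<int n}. if coprime a (int n) \<and> [a = s] (mod int (x * y))
            then expi (real_of_int (a * k) / real n) else 0)
       = (if int b dvd k \<and> coprime (int x) s \<and> coprime (int y) s
          then of_nat b * of_nat (totient n2) / of_nat (totient y)
               * expi (real_of_int (k * s) / real n) else 0)"
proof -
  define P where "P a \<longleftrightarrow> coprime a (int n) \<and> [a = s] (mod int (x * y))" for a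
  have dn: "x * y dvd n" using n(2) n1 y by (simp add: mult_dvd_mono)
  have pos: "n1 > 0" "n2 > 0" "x > 0" "b > 0" "y > 0"
    using n n1 y by (auto intro!: Nat.gr0I)
  have P_cong: "P a = P a'" if "[a = a'] (mod int n)" for a a'
    using that dn unfolding P_def
    by (metis coprime_residue_cong cong_dvd_modulus cong_sym cong_trans int_dvd_int_iff)
  have cop_xy: "coprime s (int (x * y)) \<longleftrightarrow> coprime (int x) s \<and> coprime (int y) s"
    by (simp add: coprime_mult_right_iff coprime_commute)
  consider "\<not> coprime s (int (x * y))" | "\<not> int b dvd k"
    | "coprime s (int (x * y))" "int b dvd k" by blast
  then have "(\<Sum>a\<in>{0..<int n}. if P a then expi (real_of_int (a * k) / real n) else 0)
       = (if int b dvd k \<and> coprime s (int (x * y))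
          then of_nat b * of_nat (totient n2) / of_nat (totient y)
               * expi (real_of_int (k * s) / real n) else 0)"
  proof cases
    case 1
    have "\<not> P a" for a
    proof
      assume "P a"
      then have "coprime a (int (x * y))" "[a = s] (mod int (x * y))"
        using dn unfolding P_def by (meson coprime_divisors dvd_refl int_dvd_int_iff, blast)
      then show False using 1 coprime_residue_cong by blast
    qed
    with 1 show ?thesis by (simp only: if_False simp_thms sum.neutral_const)
  next
    case 2
    obtain c :: nat where c: "x * y dvd c" "\<not> int n dvd int c * k"
      "\<And>p :: int. prime p \<Longrightarrow> p dvd int n \<Longrightarrow> p dvd int c"
      using valuation_gap_shift [OF n gap n1 y 2] by blast
    have "P (a + int c) = P a" for a
    proof -
      have "coprime (a + int c) (int n) \<longleftrightarrow> coprime a (int n)"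
        using c(3) n(1) by (intro coprime_add_radical_multiple) auto
      moreover have "[a + int c = a] (mod int (x * y))"
        using c(1) by (simp add: cong_iff_dvd_diff del: of_nat_mult)
      ultimately show ?thesis unfolding P_def by (meson cong_sym cong_trans)
    qed
    with n(1) P_cong c(2) have
      "(\<Sum>a\<in>{0..<int n}. if P a then expi (real_of_int (a * k) / real n) else 0) = 0"
      by (intro twisted_sum_invariant_eq_0 [of n P "int c" k])
    with 2 show ?thesis by simp
  next
    case 3
    have val: "expi (real_of_int (a * k) / real n) = expi (real_of_int (k * s) / real n)"
      if "P a" for a
    proof (rule expi_divide_cong [OF n(1)])
      have "int (x * y) dvd a - s" using that by (simp add: P_def cong_iff_dvd_diff)
      then have "int x dvd a - s" by (simp add: dvd_mult_left)
      moreover have "int b * int n2 dvd k"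
        using 3(2) n2 cop n1 by (intro divides_mult) auto
      ultimately have "int x * (int b * int n2) dvd (a - s) * k" by (rule mult_dvd_mono)
      then show "[a * k = k * s] (mod int n)"
        by (simp add: cong_iff_dvd_diff n(2) n1 algebra_simps)
    qed
    have "(\<Sum>a\<in>{0..<int n}. if P a then expi (real_of_int (a * k) / real n) else 0)
        = (\<Sum>a\<in>{0..<int n}. if P a then 1 else 0) * expi (real_of_int (k * s) / real n)"
      unfolding sum_distrib_right
    proof (intro sum.cong refl)
      fix a
      show "(if P a then expi (real_of_int (a * k) / real n) else 0)
          = (if P a then 1 else 0) * expi (real_of_int (k * s) / real n)"
        by (cases "P a") (simp_all only: val if_True if_False mult_1_left mult_zero_left)
    qed
    moreover have "(\<Sum>a\<in>{0..<int n}. if P a then 1 else 0)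
        = (of_nat b * of_nat (totient n2) / of_nat (totient y) :: complex)"
    proof -
      have "totient n1 = b * totient x"
        using valuation_gap_prime_factors [OF gap pos(1) n1 3(2)] pos
        by (simp add: n1 totient_same_prime_factors)
      then have "totient n = b * totient x * totient n2"
        using cop n(2) by (simp add: totient_mult_coprime)
      moreover have "totient (x * y) = totient x * totient y"
        using cop n1 y by (intro totient_mult_coprime) (meson coprime_divisors dvd_triv_left)
      moreover have "of_nat (totient (x * y)) * (\<Sum>a\<in>{0..<int n}. if P a then 1 else 0)
          = (of_nat (totient n) :: complex)"
        unfolding P_def by (rule count_lifts [OF n(1) dn 3(1)])
      ultimately show ?thesis using pos by (simp add: field_simps)
    qed
    ultimately show ?thesis using 3 by simp
  qed
  then show ?thesis unfolding P_def cop_xy by blast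
qed

text \<open>
  The common form of the three formulas. The factor \<open>d\<close> in the hypothesis on \<open>g\<close> is the
  \<open>b\<close> in the value of \<open>T(x y)\<close>, with \<open>x = n\<^sub>1/d\<close>; only divisors \<open>d\<close> of \<open>k\<close> contribute,
  so the factorisation of \<open>g\<close> is required only for these.
\<close>

lemma twisted_unit_sum_of_divisor_sum:
  fixes n n1 n2 :: nat and s k :: int and g X Y :: "nat \<Rightarrow> real"
  assumes n: "n > 0" "n = n1 * n2" and cop: "coprime n1 n2"
    and gap: "valuation_gap n1 k" and n2: "int n2 dvd k"
    and g: "\<And>d y. d dvd n1 \<Longrightarrow> int d dvd k \<Longrightarrow> y dvd n2 \<Longrightarrow> g (n1 div d * y) * real d = A * X d * Y y"
  shows "(\<Sum>a | a \<in> {1..n} \<and> coprime a n.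
        complex_of_real (\<Sum>d | d dvd n \<and> int d dvd int a - s. g d)
          * expi (real a * real_of_int k / real n))
     = expi (real_of_int (k * s) / real n) * complex_of_real (
         A * real (totient n2)
         * (\<Sum>d | int d dvd gcd (int n1) k \<and> coprime (int (n1 div d)) s. X d)
         * (\<Sum>d | d dvd n2 \<and> coprime (int d) s. Y d / real (totient d)))"
proof -
  define E where "E a = expi (real_of_int (a * k) / real n)" for a :: int
  define e where "e = expi (real_of_int (k * s) / real n)"
  define T where "T d = (\<Sum>a\<in>{0..<int n}. if coprime a (int n) \<and> [a = s] (mod int d) then E a else 0)"
    for d
  have pos: "n1 > 0" "n2 > 0" using n by (auto intro!: Nat.gr0I)
  have fin: "finite {d. d dvd n}" "finite {d. d dvd n1}" "finite {d. d dvd n2}"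
    using n pos by simp_all
  have divisor_sum: "complex_of_real (\<Sum>d | d dvd n \<and> int d dvd a - s. g d)
      = (\<Sum>d | d dvd n. if [a = s] (mod int d) then of_real (g d) else 0)" for a
    using sum.inter_filter [OF fin(1), of "\<lambda>d. complex_of_real (g d)" "\<lambda>d. int d dvd a - s"]
    by (simp add: cong_iff_dvd_diff)
  have "(\<Sum>a | a \<in> {1..n} \<and> coprime a n.
        complex_of_real (\<Sum>d | d dvd n \<and> int d dvd int a - s. g d)
          * expi (real a * real_of_int k / real n))
     = (\<Sum>a | a \<in> {1..n} \<and> coprime (int a) (int n).
        (\<Sum>d | d dvd n. if [int a = s] (mod int d) then of_real (g d) else 0) * E (int a))"
    unfolding divisor_sum by (simp add: E_def)
  also have "\<dots> = (\<Sum>a\<in>{0..<int n}. if coprime a (int n) then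
        (\<Sum>d | d dvd n. if [a = s] (mod int d) then of_real (g d) else 0) * E a else 0)"
  proof (rule sum_filter_residues
      [where F = "\<lambda>a. (\<Sum>d | d dvd n. if [a = s] (mod int d) then of_real (g d) else 0) * E a"])
    fix a a' assume aa': "[a = a'] (mod int n)"
    show "coprime a (int n) = coprime a' (int n)" using aa' by (rule coprime_residue_cong)
    have "[a = s] (mod int d) = [a' = s] (mod int d)" if "d dvd n" for d
      using aa' that by (meson cong_dvd_modulus cong_sym cong_trans int_dvd_int_iff)
    moreover have "E a = E a'"
      unfolding E_def using aa' n by (intro expi_divide_cong cong_scalar_right)
    ultimately show "(\<Sum>d | d dvd n. if [a = s] (mod int d) then of_real (g d) else 0) * E a
      = (\<Sum>d | d dvd n. if [a' = s] (mod int d) then of_real (g d) else 0) * E a'"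
      by simp
  qed
  also have "\<dots> = (\<Sum>a\<in>{0..<int n}. \<Sum>d | d dvd n. of_real (g d) *
      (if coprime a (int n) \<and> [a = s] (mod int d) then E a else 0))"
    by (intro sum.cong refl) (auto simp: sum_distrib_right intro!: sum.cong)
  also have "\<dots> = (\<Sum>d | d dvd n. of_real (g d) * T d)"
    unfolding T_def sum_distrib_left by (rule sum.swap)
  also have "\<dots> = (\<Sum>x | x dvd n1. \<Sum>y | y dvd n2. of_real (g (x * y)) * T (x * y))"
    unfolding n(2) using cop pos by (rule sum_divisors_coprime_product)
  also have "\<dots> = (\<Sum>d | d dvd n1. \<Sum>y | y dvd n2. of_real (g (n1 div d * y)) * T (n1 div d * y))"
    using pos(1) by (rule sum_divisors_complementary)
  also have "\<dots> = (\<Sum>d | d dvd n1. \<Sum>y | y dvd n2. e * of_real (A * real (totient n2)) *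
      (of_real (if int d dvd k \<and> coprime (int (n1 div d)) s then X d else 0) *
       of_real (if coprime (int y) s then Y y / real (totient y) else 0)))"
  proof (intro sum.cong refl)
    fix d y assume "d \<in> {d. d dvd n1}" "y \<in> {y. y dvd n2}"
    then have d: "d dvd n1" and y: "y dvd n2" by simp_all
    have "T (n1 div d * y) = (if int d dvd k \<and> coprime (int (n1 div d)) s \<and> coprime (int y) s
          then of_nat d * of_nat (totient n2) / of_nat (totient y) * e else 0)"
      unfolding T_def E_def e_def using d
      by (intro twisted_residue_class_sum [OF n cop gap n2 _ y]) simp
    moreover have "complex_of_real (g (n1 div d * y)) * of_nat d = of_real (A * X d * Y y)" if "int d dvd k"
      using g [OF d that y] by (metis of_real_mult of_real_of_nat_eq)
    ultimately show "of_real (g (n1 div d * y)) * T (n1 div d * y)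
      = e * of_real (A * real (totient n2)) *
      (of_real (if int d dvd k \<and> coprime (int (n1 div d)) s then X d else 0) *
       of_real (if coprime (int y) s then Y y / real (totient y) else 0))"
      by (simp add: mult_ac)
  qed
  also have "\<dots> = e * of_real (A * real (totient n2)) *
      ((\<Sum>d | d dvd n1. of_real (if int d dvd k \<and> coprime (int (n1 div d)) s then X d else 0)) *
       (\<Sum>y | y dvd n2. of_real (if coprime (int y) s then Y y / real (totient y) else 0)))"
    by (subst sum_product) (simp only: sum_distrib_left)
  also have "\<dots> = e * of_real (A * real (totient n2)
      * (\<Sum>d | d dvd n1. if int d dvd k \<and> coprime (int (n1 div d)) s then X d else 0)
      * (\<Sum>y | y dvd n2. if coprime (int y) s then Y y / real (totient y) else 0))"
    by (simp only: of_real_mult of_real_sum mult.assoc)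
  also have "(\<Sum>d | d dvd n1. if int d dvd k \<and> coprime (int (n1 div d)) s then X d else 0)
      = (\<Sum>d | int d dvd gcd (int n1) k \<and> coprime (int (n1 div d)) s. X d)"
    by (subst sum.inter_filter [OF fin(2), symmetric]) (simp add: conj_assoc)
  also have "(\<Sum>y | y dvd n2. if coprime (int y) s then Y y / real (totient y) else 0)
      = (\<Sum>d | d dvd n2 \<and> coprime (int d) s. Y d / real (totient d))"
    by (subst sum.inter_filter [OF fin(3), symmetric]) simp
  finally show ?thesis by (simp only: e_def)
qed

section \<open>From valuations to divisibility\<close>

lemma padic_val_imp_valuation_gap:
  assumes n: "n > 0" "n = n1 * n2" and cop: "coprime n1 n2"
    and val: "\<And>p :: nat. prime p \<Longrightarrow> p dvd n1 \<Longrightarrow> padic_val p (int n) \<ge> padic_val p k + 2"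
  shows "valuation_gap n1 k"
  unfolding valuation_gap_def
proof (intro allI impI)
  fix p assume p: "prime p" "p dvd n1"
  \<comment> \<open>The valuation of \<open>n\<close> is finite, that of 0 is not.\<close>
  have "k \<noteq> 0" using val [OF p] n(1) by (auto simp: padic_val_def)
  define v where "v = multiplicity (int p) k"
  have "enat (v + 2) \<le> enat (multiplicity (int p) (int n))"
    using val [OF p] n(1) \<open>k \<noteq> 0\<close> by (simp add: padic_val_def v_def numeral_eq_enat)
  then have "int p ^ (v + 2) dvd int n" by (intro multiplicity_dvd') simp
  then have "p ^ (v + 2) dvd n1 * n2" by (metis n(2) int_dvd_int_iff of_nat_power)
  moreover have "coprime (p ^ (v + 2)) n2"
    using cop p(2) by (intro coprime_power_left_iff [THEN iffD2] disjI1)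
      (meson coprime_divisors dvd_refl)
  ultimately have "p ^ (v + 2) dvd n1" by (simp only: coprime_dvd_mult_left_iff)
  moreover have "\<not> int (p ^ (v + 1)) dvd k"
    using p \<open>k \<noteq> 0\<close> unfolding of_nat_power v_def
    by (subst power_dvd_iff_le_multiplicity) (auto simp: not_prime_unit)
  ultimately show "\<exists>v. p ^ (v + 2) dvd n1 \<and> \<not> int (p ^ (v + 1)) dvd k" by blast
qed

lemma padic_val_le_imp_dvd:
  assumes n: "n > 0" "n = n1 * n2"
    and val: "\<And>p :: nat. prime p \<Longrightarrow> p dvd n2 \<Longrightarrow> padic_val p (int n) \<le> padic_val p k"
  shows "int n2 dvd k"
proof (rule ccontr)
  assume nd: "\<not> int n2 dvd k"
  have "n2 > 0" using n by (auto intro!: Nat.gr0I)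
  then obtain p j where p: "prime p" "p ^ j dvd n2" "\<not> int (p ^ j) dvd k"
    using prime_power_witness_not_dvd nd by metis
  have "j > 0" using p(3) by (cases j) auto
  then have "p dvd n2" using p(2) by (metis dvd_power dvd_trans)
  have "k \<noteq> 0" using nd by auto
  have "multiplicity (int p) (int n) \<le> multiplicity (int p) k"
    using val [OF p(1) \<open>p dvd n2\<close>] n(1) \<open>k \<noteq> 0\<close> by (simp add: padic_val_def)
  moreover have "j \<le> multiplicity (int p) (int n)"
  proof (rule multiplicity_geI)
    show "int p ^ j dvd int n" using p(2) n(2)
      by (metis dvd_mult int_dvd_int_iff of_nat_power)
  qed (use p(1) n(1) not_prime_unit [of p] in auto)
  ultimately have "int p ^ j dvd k" by (intro multiplicity_dvd') simp
  with p(3) show False by simp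
qed

text \<open>
  For these \<open>d\<close> the numbers \<open>n\<close> and \<open>n/d\<close> have the same prime divisors, so the Euler
  products of both Jordan functions coincide and only the powers differ.
\<close>

lemma jordan_quotient:
  assumes gap: "valuation_gap n k" and "n > 0" and d: "d dvd n" "int d dvd k"
  shows "jordan m (n div d) * real d = jordan m n * real d powr (1 - m)"
proof -
  obtain b where b: "n = b * d" using d(1) by (metis dvd_def mult.commute)
  have pos: "b > 0" "d > 0" using b \<open>n > 0\<close> by auto
  have "prime_factors n = prime_factors b"
    using valuation_gap_prime_factors [OF gap \<open>n > 0\<close> b d(2)] .
  then have "jordan m n = jordan m b * real d powr m"
    using pos by (simp add: jordan_def b powr_mult)
  moreover have "real d powr m * real d powr (1 - m) = real d"
    using pos by (simp flip: powr_add)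
  ultimately have "jordan m n * real d powr (1 - m) = jordan m b * real d"
    by (simp add: mult.assoc)
  then show ?thesis using b pos by simp
qed

section \<open>The three sums\<close>

theorem corollary3p7:
  fixes n n1 n2 :: nat and s k :: int and m :: real
  assumes "n \<ge> 1"
    and "\<And>p :: nat. prime p \<Longrightarrow> p dvd n \<Longrightarrow> padic_val p (int n) \<noteq> padic_val p k + 1"
    and "n1 \<ge> 1" and "n2 \<ge> 1" and "n = n1 * n2" and "coprime n1 n2"
    and "\<And>p :: nat. prime p \<Longrightarrow> p dvd n1 \<Longrightarrow> padic_val p (int n) \<ge> padic_val p k + 2"
    and "\<And>p :: nat. prime p \<Longrightarrow> p dvd n2 \<Longrightarrow> padic_val p (int n) \<le> padic_val p k"
  shows
    "(\<Sum>a | a \<in> {1..n} \<and> coprime a n.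
        complex_of_real (real_of_int (gcd (int a - s) (int n)) powr m)
          * expi (real a * real_of_int k / real n))
     = expi (real_of_int (k * s) / real n) * complex_of_real (
         jordan m n1 * real (totient n2)
         * (\<Sum>d :: nat | int d dvd gcd (int n1) k \<and> coprime (int (n1 div d)) s. real d powr (1 - m))
         * (\<Sum>d :: nat | d dvd n2 \<and> coprime (int d) s. jordan m d / real (totient d)))
     \<and>
     (\<Sum>a | a \<in> {1..n} \<and> coprime a n.
        complex_of_real (divisor_sigma m (nat (gcd (int a - s) (int n))))
          * expi (real a * real_of_int k / real n))
     = expi (real_of_int (k * s) / real n) * complex_of_real (
         real n1 powr m * real (totient n2)
         * (\<Sum>d :: nat | int d dvd gcd (int n1) k \<and> coprime (int (n1 div d)) s. real d powr (1 - m))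
         * (\<Sum>d :: nat | d dvd n2 \<and> coprime (int d) s. real d powr m / real (totient d)))
     \<and>
     (\<Sum>a | a \<in> {1..n} \<and> coprime a n.
        ramanujan_sum n (int a - s) * expi (real a * real_of_int k / real n))
     = expi (real_of_int (k * s) / real n) * complex_of_real (
         real n1 * real (totient n2)
         * (\<Sum>d :: nat | int d dvd gcd (int n1) k \<and> coprime (int (n1 div d)) s. real_of_int (moebius d))
         * (\<Sum>d :: nat | d dvd n2 \<and> coprime (int d) s.
              real d * real_of_int (moebius (n2 div d)) / real (totient d)))"
proof -
  have n: "n > 0" using assms(1) by simp
  have pos: "n1 > 0" "n2 > 0" using assms(3,4) by simp_all
  have gap: "valuation_gap n1 k"
    using padic_val_imp_valuation_gap [OF n assms(5,6,7)] .
  have n2: "int n2 dvd k"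
    using padic_val_le_imp_dvd [OF n assms(5,8)] .
  note twisted = twisted_unit_sum_of_divisor_sum [OF n assms(5,6) gap n2]
  have gcd_pos: "nat (gcd z (int n)) > 0" for z using n by (simp add: gcd_pos_int)
  have dvd_gcd: "d dvd nat (gcd z (int n)) \<longleftrightarrow> d dvd n \<and> int d dvd z" for d z
    using n by (auto simp: nat_dvd_iff dvd_nat_abs_iff simp flip: int_dvd_int_iff)
  have quot: "coprime (n1 div d) y" "n1 div d > 0" "y > 0" "d > 0"
    if d: "d dvd n1" and y: "y dvd n2" for d y
  proof -
    have "n1 div d dvd n1" using d by (metis dvd_div_mult_self dvd_triv_left)
    then show "coprime (n1 div d) y" using y assms(6) by (rule coprime_divisors)
    show "n1 div d > 0" "d > 0" using d pos by (auto elim!: dvdE)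
    show "y > 0" using y pos by (auto elim!: dvdE)
  qed

  have gcd_powr: "real_of_int (gcd z (int n)) powr m
      = (\<Sum>d | d dvd n \<and> int d dvd z. jordan m d)" for z
    using sum_divisors_jordan [OF gcd_pos [of z], of m] n
    by (simp add: dvd_gcd gcd_ge_0_int)
  have sigma: "divisor_sigma m (nat (gcd z (int n)))
      = (\<Sum>d | d dvd n \<and> int d dvd z. real d powr m)" for z
    by (simp add: divisor_sigma_def dvd_gcd)
  have ramanujan: "ramanujan_sum n z = complex_of_real
      (\<Sum>d | d dvd n \<and> int d dvd z. real d * real_of_int (moebius (n div d)))" for z
    by (simp add: ramanujan_sum_divisor_formula [OF n])

  have "jordan m (n1 div d * y) * real d
      = jordan m n1 * real d powr (1 - m) * jordan m y"
    if d: "d dvd n1" "int d dvd k" and y: "y dvd n2" for d y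
    using jordan_quotient [OF gap pos(1) d, of m] jordan_mult_coprime [OF quot(1-3) [OF d(1) y], of m]
    by (simp add: mult_ac)
  moreover have "real (n1 div d * y) powr m * real d
      = real n1 powr m * real d powr (1 - m) * real y powr m"
    if d: "d dvd n1" "int d dvd k" and y: "y dvd n2" for d y
  proof -
    obtain b where b: "n1 = d * b" using d(1) by (elim dvdE)
    have "d > 0" "b > 0" using b pos by auto
    moreover from this have "real d powr m * real d powr (1 - m) = real d"
      by (simp flip: powr_add)
    ultimately show ?thesis by (simp add: b powr_mult mult_ac)
  qed
  moreover have "real (n1 div d * y) * real_of_int (moebius (n div (n1 div d * y))) * real d
      = real n1 * real_of_int (moebius d) * (real y * real_of_int (moebius (n2 div y)))"
    if d: "d dvd n1" "int d dvd k" and y: "y dvd n2" for d y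
  proof -
    obtain b z where b: "n1 = d * b" and z: "n2 = y * z" using d(1) y by (elim dvdE)
    have gt0: "d > 0" "b > 0" "y > 0" "z > 0" using b z pos by auto
    have "n div (b * y) = d * z"
    proof -
      have "n = (b * y) * (d * z)" by (simp add: assms(5) b z)
      then show ?thesis using gt0 by simp
    qed
    moreover have "coprime d z"
      using assms(6) unfolding b z by (simp add: coprime_mult_left_iff coprime_mult_right_iff)
    ultimately show ?thesis
      using gt0 by (simp add: b z moebius_mult_coprime)
  qed
  ultimately show ?thesis
    unfolding gcd_powr sigma ramanujan by (intro conjI twisted) blast+
qed

end
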